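(* Let $n,m,l$ be positive integers with $m,l\le n$, and let $A\in\mathbb{R}^{n\times n}$, $B\in\mathbb{R}^{n\times m}$, $C\in\mathbb{R}^{l\times n}$, with $B$ and $C^{\mathsf T}$ of full column rank. Set $A_0=A$, $G_0=BB^{\mathsf T}$, $H_0=C^{\mathsf T}C$ and, for $k\ge 0$, let $A_{k+1},G_{k+1},H_{k+1}$ be defined by the structure-preserving doubling algorithm (SDA) $$A_{k+1}=A_k(I_n+G_kH_k)^{-1}A_k,$$ $$G_{k+1}=G_k+A_k(I_n+G_kH_k)^{-1}G_kA_k^{\mathsf T},$$ $$H_{k+1}=H_k+A_k^{\mathsf T}H_k(I_n+G_kH_k)^{-1}A_k,$$ where it is assumed that $I_n+G_kH_k$ is nonsingular for all $k\ge 0$. Let $U_0=B$, $V_0=C^{\mathsf T}$ and, for $j\ge1$, $U_j:=A_0U_{j-1}$, $V_j:=A_0^{\mathsf T}V_{j-1}$. For $k\ge 1$ put $\widehat U_k:=[U_0,U_1,\ldots,U_{2^k-1}]$, $\widehat V_k:=[V_0,V_1,\ldots,V_{2^k-1}]$ and $T_k:=\widehat U_k^{\mathsf T}\widehat V_k$. Let $$Y_1=\begin{bmatrix} 0 & 0 \\ 0 & B^{\mathsf T}C^{\mathsf T} \end{bmatrix}\in\mathbb{R}^{2m\times 2l},\qquad Y_k:=\begin{bmatrix} 0 & Y_{k-1} \\ Y_{k-1} & T_{k-1} \end{bmatrix}\in\mathbb{R}^{2^km\times2^kl}\quad(k\ge2).$$ Then for all $k\ge2$, $$A_k=A_0^{2^k}-\widehat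 U_k\left(I_{2^km}+Y_kY_k^{\mathsf T}\right)^{-1}Y_k\widehat V_k^{\mathsf T},$$ $$G_k=\widehat U_k\left(I_{2^km}+Y_kY_k^{\mathsf T}\right)^{-1}\widehat U_k^{\mathsf T},\qquad H_k=\widehat V_k\left(I_{2^kl}+Y_k^{\mathsf T}Y_k\right)^{-1}\widehat V_k^{\mathsf T}.$$
   Context: $I_p$ is the $p\times p$ identity matrix and $M^{\mathsf T}$ is the transpose of $M$. $[U_0,\ldots,U_q]$ denotes the block row matrix obtained by concatenating columns. The SDA is the iteration used to solve the discrete-time algebraic Riccati equation $-X+A^{\mathsf T}X(I+GX)^{-1}A+H=0$ with $G=BB^{\mathsf T}$, $H=C^{\mathsf T}C$. *)

theory Defs
  imports
    "Jordan_Normal_Form.Gauss_Jordan_Elimination"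
    "Jordan_Normal_Form.DL_Rank"
begin

text \<open>The library's inverse is option-valued. The total version below is the inverse exactly on
  invertible matrices and is unspecified elsewhere.\<close>

definition mat_inv :: "'a :: field mat \<Rightarrow> 'a mat" where
  "mat_inv M = the (mat_inverse M)"

lemma mat_inv:
  assumes M: "M \<in> carrier_mat n n" and inv: "invertible_mat M"
  shows "mat_inv M \<in> carrier_mat n n" "M * mat_inv M = 1\<^sub>m n" "mat_inv M * M = 1\<^sub>m n"
proof -
  from inv obtain N where N: "M * N = 1\<^sub>m (dim_row M)" "N * M = 1\<^sub>m (dim_row N)"
    unfolding invertible_mat_def inverts_mat_def by blast
  have "dim_col (M * N) = n" "dim_col (N * M) = dim_row N"
    using M N by auto
  then have "N \<in> carrier_mat n n" using M by auto
  then have "M \<in> Units (ring_mat TYPE('a) n ())"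
    unfolding Units_def ring_mat_def using M N by auto
  then obtain P where P: "mat_inverse M = Some P"
    using mat_inverse(1)[OF M, of "()"] by (cases "mat_inverse M") auto
  then show "mat_inv M \<in> carrier_mat n n" "M * mat_inv M = 1\<^sub>m n" "mat_inv M * M = 1\<^sub>m n"
    using mat_inverse(2)[OF M P] by (auto simp: mat_inv_def)
qed

text \<open>Matrices of the form \<open>I + M M\<^sup>T\<close> are always invertible over the reals, so
  \<^const>\<open>mat_inv\<close> is a genuine inverse on them.\<close>

lemma invertible_one_plus_gram:
  fixes M :: "real mat"
  assumes M: "M \<in> carrier_mat p q"
  shows "invertible_mat (1\<^sub>m p + M * M\<^sup>T)"
proof -
  let ?S = "1\<^sub>m p + M * M\<^sup>T"
  have S: "?S \<in> carrier_mat p p" using M by auto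
  have "det ?S \<noteq> 0"
  proof
    assume "det ?S = 0"
    then obtain v where v: "v \<in> carrier_vec p" "v \<noteq> 0\<^sub>v p" "?S *\<^sub>v v = 0\<^sub>v p"
      using det_0_iff_vec_prod_zero_field[OF S] by blast
    have Mv: "M\<^sup>T *\<^sub>v v \<in> carrier_vec q" using M v by auto
    have "?S *\<^sub>v v = v + M *\<^sub>v (M\<^sup>T *\<^sub>v v)"
      using M v by (simp add: add_mult_distrib_mat_vec[of _ p p] assoc_mult_mat_vec[of _ p q _ p])
    with v(3) have "v + M *\<^sub>v (M\<^sup>T *\<^sub>v v) = 0\<^sub>v p" by argo
    then have "0 = v \<bullet> (v + M *\<^sub>v (M\<^sup>T *\<^sub>v v))"
      by (metis v(1) scalar_prod_right_zero)
    also have "\<dots> = v \<bullet> v + v \<bullet> (M *\<^sub>v (M\<^sup>T *\<^sub>v v))"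
      using M v Mv by (intro scalar_prod_add_distrib[of _ p]) auto
    also have "v \<bullet> (M *\<^sub>v (M\<^sup>T *\<^sub>v v)) = (M\<^sup>T *\<^sub>v v) \<bullet> (M\<^sup>T *\<^sub>v v)"
      using transpose_vec_mult_scalar[OF M Mv v(1)] by simp
    finally have "0 = v \<bullet> v + (M\<^sup>T *\<^sub>v v) \<bullet> (M\<^sup>T *\<^sub>v v)" .
    moreover have "(M\<^sup>T *\<^sub>v v) \<bullet> (M\<^sup>T *\<^sub>v v) \<ge> 0" "v \<bullet> v \<ge> 0"
      by (auto simp: scalar_prod_def intro!: sum_nonneg)
    ultimately have "v \<bullet> v = 0" by linarith
    then have "\<forall>i\<in>{0..<p}. v $ i * v $ i = 0"
      using v(1) unfolding scalar_prod_def by (subst (asm) sum_nonneg_eq_0_iff) auto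
    then have "v = 0\<^sub>v p" using v(1) by (intro eq_vecI) auto
    with v(2) show False by blast
  qed
  then have "?S \<in> Units (ring_mat TYPE(real) p ())" by (rule det_non_zero_imp_unit[OF S])
  then obtain N where "N \<in> carrier_mat p p" "?S * N = 1\<^sub>m p" "N * ?S = 1\<^sub>m p"
    unfolding Units_def ring_mat_def by auto
  then show ?thesis
    using S unfolding invertible_mat_def inverts_mat_def by (intro conjI exI[of _ N]) auto
qed

text \<open>\<open>block_row n [M\<^sub>0, \<dots>, M\<^sub>q]\<close> is the concatenation \<open>[M\<^sub>0, \<dots>, M\<^sub>q]\<close> of the
  columns of matrices that all have \<open>n\<close> rows.\<close>

definition block_row :: "nat \<Rightarrow> 'a mat list \<Rightarrow> 'a mat" where
  "block_row n Ms = mat_of_cols n (concat (map cols Ms))"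

end

theory Submission
  imports Defs
begin

text \<open>The representation is preserved by a single SDA step, and it already holds for \<open>k = 0\<close> with
  \<open>U = B\<close>, \<open>V = C\<^sup>T\<close>, \<open>Y = 0\<close>. With \<open>P = (I + Y Y\<^sup>T)\<^sup>-\<^sup>1\<close>, \<open>Q = (I + Y\<^sup>T Y)\<^sup>-\<^sup>1\<close>, \<open>T = U\<^sup>T V\<close> and
  \<open>Y' = [[0, Y], [Y, T]]\<close>, the Schur complement of \<open>P\<^sup>-\<^sup>1\<close> in \<open>I + Y' Y'\<^sup>T\<close> is \<open>S = P\<^sup>-\<^sup>1 + T Q T\<^sup>T\<close>. This same
  matrix appears in the SDA step, because \<open>(I + G H)\<^sup>-\<^sup>1 G = U S\<^sup>-\<^sup>1 U\<^sup>T\<close>. The formula for \<open>H\<close> is the one for \<open>G\<close>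
  with \<open>A, U, Y\<close> replaced by \<open>A\<^sup>T, V, Y\<^sup>T\<close>.\<close>

section \<open>Block rows and their products\<close>

text \<open>Encoded as a four-block matrix with an empty lower block row, so that the library's laws
  for multiplying and transposing four-block matrices apply.\<close>

definition append_cols :: "'a :: zero mat \<Rightarrow> 'a mat \<Rightarrow> 'a mat" where
  "append_cols M N = four_block_mat M N (0\<^sub>m 0 (dim_col M)) (0\<^sub>m 0 (dim_col N))"

lemma dim_append_cols [simp]:
  "dim_row (append_cols M N) = dim_row M"
  "dim_col (append_cols M N) = dim_col M + dim_col N"
  by (auto simp: append_cols_def)

lemma append_cols_mult_four_block_mat:
  fixes M N a b c d :: "'a :: semiring_1 mat"
  assumes "M \<in> carrier_mat n p" "N \<in> carrier_mat n q"
    and "a \<in> carrier_mat p r" "b \<in> carrier_mat p s" "c \<in> carrier_mat q r" "d \<in> carrier_mat q s"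
  shows "append_cols M N * four_block_mat a b c d = append_cols (M * a + N * c) (M * b + N * d)"
  using assms mult_four_block_mat[of M n p N q "0\<^sub>m 0 p" 0 "0\<^sub>m 0 q" a r b s c d]
  by (auto simp: append_cols_def intro!: arg_cong2[where f = "four_block_mat _ _"])

lemma append_cols_mult_transpose:
  fixes M N K L :: "'a :: comm_semiring_1 mat"
  assumes "M \<in> carrier_mat n p" "N \<in> carrier_mat n q" "K \<in> carrier_mat r p" "L \<in> carrier_mat r q"
  shows "append_cols M N * (append_cols K L)\<^sup>T = M * K\<^sup>T + N * L\<^sup>T"
proof -
  \<comment> \<open>The transpose is a block column. Its right-hand blocks have no columns; they
    only complete the four-block form needed by the product law.\<close>
  have "(append_cols K L)\<^sup>T = four_block_mat K\<^sup>T (0\<^sub>m p 0) L\<^sup>T (0\<^sub>m q 0)"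
    using assms transpose_four_block_mat[of K r p L q "0\<^sub>m 0 p" 0 "0\<^sub>m 0 q"]
    by (auto simp: append_cols_def)
  then have "append_cols M N * (append_cols K L)\<^sup>T
      = append_cols (M * K\<^sup>T + N * L\<^sup>T) (M * 0\<^sub>m p 0 + N * 0\<^sub>m q 0)"
    using assms by (simp add: append_cols_mult_four_block_mat[of _ n p _ q _ r _ 0])
  also have "\<dots> = M * K\<^sup>T + N * L\<^sup>T"
    using assms by (intro eq_matI) (auto simp: append_cols_def)
  finally show ?thesis .
qed

lemma dim_row_block_row [simp]: "dim_row (block_row n Ms) = n"
  by (simp add: block_row_def)

lemma dim_col_block_row: "dim_col (block_row n Ms) = (\<Sum>M\<leftarrow>Ms. dim_col M)"
  by (induction Ms) (auto simp: block_row_def)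

lemma block_row_singleton: "M \<in> carrier_mat n p \<Longrightarrow> block_row n [M] = M"
  by (auto simp: block_row_def)

lemma block_row_append: "block_row n (Ms @ Ns) = append_cols (block_row n Ms) (block_row n Ns)"
  by (rule eq_matI) (auto simp: block_row_def append_cols_def mat_of_cols_index nth_append)

text \<open>Left multiplication acts on each column separately, and a block row is just the list of
  all columns.\<close>

lemma mult_block_row:
  fixes F :: "'a :: semiring_0 mat"
  assumes F: "F \<in> carrier_mat n n" and Ms: "\<forall>M\<in>set Ms. dim_row M = n"
  shows "F * block_row n Ms = block_row n (map ((*) F) Ms)"
proof -
  define vs where "vs = concat (map cols Ms)"
  have map_vs: "concat (map cols (map ((*) F) Ms)) = map ((*\<^sub>v) F) vs"
    unfolding vs_def using Ms F by (induction Ms) (auto simp: cols_def intro!: nth_equalityI)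
  have "set vs \<subseteq> carrier_vec n"
    unfolding vs_def using Ms by (auto simp: cols_def)
  then have "vs ! j \<in> carrier_vec n" if "j < length vs" for j
    using nth_mem[OF that] by blast
  then have "F * mat_of_cols n vs = mat_of_cols n (map ((*\<^sub>v) F) vs)"
    using F by (intro eq_matI) (auto simp: mat_of_cols_index)
  then show ?thesis unfolding block_row_def map_vs vs_def .
qed

section \<open>Matrix ring laws and division by an inverse\<close>

text \<open>Unlike the carrier conditions of the library's laws, side conditions on dimensions leave the simplifier
  no unknowns to guess.\<close>

lemma mat_assoc: "dim_col M = dim_row N \<Longrightarrow> dim_col N = dim_row K \<Longrightarrow> M * N * K = M * (N * K)"
  for M N K :: "'a :: semiring_0 mat"
  by (rule assoc_mult_mat) auto

lemma mat_add_mult: "dim_row M = dim_row N \<Longrightarrow> dim_col M = dim_col N \<Longrightarrow> dim_col N = dim_row K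
    \<Longrightarrow> (M + N) * K = M * K + N * K"
  for M N K :: "'a :: semiring_0 mat"
  by (rule add_mult_distrib_mat) auto

lemma mat_mult_add: "dim_row M = dim_row N \<Longrightarrow> dim_col M = dim_col N \<Longrightarrow> dim_col K = dim_row N
    \<Longrightarrow> K * (M + N) = K * M + K * N"
  for M N K :: "'a :: semiring_0 mat"
  by (rule mult_add_distrib_mat) auto

lemma mat_minus_mult: "dim_row M = dim_row N \<Longrightarrow> dim_col M = dim_col N \<Longrightarrow> dim_col N = dim_row K
    \<Longrightarrow> (M - N) * K = M * K - N * K"
  for M N K :: "'a :: ring mat"
  by (rule minus_mult_distrib_mat) auto

lemma mat_mult_minus: "dim_row M = dim_row N \<Longrightarrow> dim_col M = dim_col N \<Longrightarrow> dim_col K = dim_row N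
    \<Longrightarrow> K * (M - N) = K * M - K * N"
  for M N K :: "'a :: ring mat"
  by (rule mult_minus_distrib_mat) auto

lemma mat_transpose_mult: "dim_col M = dim_row N \<Longrightarrow> (M * N)\<^sup>T = N\<^sup>T * M\<^sup>T"
  for M N :: "'a :: comm_semiring_0 mat"
  by (rule transpose_mult) auto

lemma mat_transpose_add: "dim_row M = dim_row N \<Longrightarrow> dim_col M = dim_col N \<Longrightarrow> (M + N)\<^sup>T = M\<^sup>T + N\<^sup>T"
  by (rule transpose_add) auto

lemma mat_transpose_minus:
  "dim_row M = dim_row N \<Longrightarrow> dim_col M = dim_col N \<Longrightarrow> (M - N)\<^sup>T = M\<^sup>T - N\<^sup>T"
  by (rule transpose_minus) auto

lemmas mat_ring_simps = mat_assoc mat_add_mult mat_mult_add mat_minus_mult mat_mult_minus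
  mat_transpose_mult mat_transpose_add mat_transpose_minus

text \<open>Right division by checking: a quotient is identified by multiplying a candidate back,
  without computing the inverse.\<close>

lemma mult_mat_inv_eqI:
  assumes "M \<in> carrier_mat n n" "invertible_mat M" "Z \<in> carrier_mat p n" "Z * M = K"
  shows "K * mat_inv M = Z"
proof -
  have "K * mat_inv M = Z * (M * mat_inv M)"
    using assms mat_inv(1)[OF assms(1,2)] by (simp add: assoc_mult_mat[of Z p n M n _ n, symmetric])
  then show ?thesis using assms(3) by (simp add: mat_inv(2)[OF assms(1,2)])
qed

section \<open>Inverses of \<open>I + Y Y\<^sup>T\<close> and of the Schur complement\<close>

text \<open>\<open>P\<close> is symmetric because its transpose also inverts the symmetric matrix
  \<open>I + Y Y\<^sup>T\<close>. It moves past \<open>Y\<close> because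
  \<open>(I + Y Y\<^sup>T) Y = Y (I + Y\<^sup>T Y)\<close>. The instance at \<open>Y\<^sup>T\<close>
  gives the corresponding facts about \<open>Q\<close>.\<close>

lemma gram_inv:
  fixes Y :: "real mat"
  assumes Y: "Y \<in> carrier_mat p q"
  defines "P \<equiv> mat_inv (1\<^sub>m p + Y * Y\<^sup>T)" and "Q \<equiv> mat_inv (1\<^sub>m q + Y\<^sup>T * Y)"
  shows gram_inv_carrier: "P \<in> carrier_mat p p"
    and gram_inv_left: "P + P * Y * Y\<^sup>T = 1\<^sub>m p"
    and gram_inv_right: "P + Y * Y\<^sup>T * P = 1\<^sub>m p"
    and gram_inv_sym: "P\<^sup>T = P"
    and gram_inv_push: "P * Y = Y * Q"
proof -
  have inv: "invertible_mat (1\<^sub>m p + Y * Y\<^sup>T)" "invertible_mat (1\<^sub>m q + Y\<^sup>T * Y)"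
    using invertible_one_plus_gram[OF Y] invertible_one_plus_gram[of "Y\<^sup>T" q p] Y by auto
  have c: "1\<^sub>m p + Y * Y\<^sup>T \<in> carrier_mat p p" "1\<^sub>m q + Y\<^sup>T * Y \<in> carrier_mat q q" using Y by auto
  note P = mat_inv[OF c(1) inv(1), folded P_def] and Q = mat_inv[OF c(2) inv(2), folded Q_def]
  have d: "dim_row P = p" "dim_col P = p" "dim_row Q = q" "dim_col Q = q" "dim_row Y = p" "dim_col Y = q"
    using P Q Y by auto
  show "P \<in> carrier_mat p p" by (rule P)
  show l: "P + P * Y * Y\<^sup>T = 1\<^sub>m p" using P(3) by (simp add: mat_ring_simps d)
  show r: "P + Y * Y\<^sup>T * P = 1\<^sub>m p" using P(2) by (simp add: mat_ring_simps d)
  have "P\<^sup>T * (1\<^sub>m p + Y * Y\<^sup>T) = ((1\<^sub>m p + Y * Y\<^sup>T) * P)\<^sup>T"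
    by (simp add: mat_ring_simps d)
  also have "\<dots> = 1\<^sub>m p" using P(2) by simp
  finally have "P\<^sup>T * (1\<^sub>m p + Y * Y\<^sup>T) = 1\<^sub>m p" .
  from mult_mat_inv_eqI[OF c(1) inv(1) _ this] P(1) show "P\<^sup>T = P"
    by (simp add: P_def[symmetric])
  have "Y * Q = (P * (1\<^sub>m p + Y * Y\<^sup>T)) * (Y * Q)" using P(3) d by simp
  also have "\<dots> = P * Y * ((1\<^sub>m q + Y\<^sup>T * Y) * Q)" by (simp add: mat_ring_simps d)
  also have "\<dots> = P * Y" using Q(2) d by simp
  finally show "P * Y = Y * Q" by simp
qed

text \<open>Block elimination first produces
  \<open>I + Y Y\<^sup>T + T (I - Y\<^sup>T P Y) T\<^sup>T\<close>; the identity
  \<open>Q + Y\<^sup>T P Y = I\<close> turns this into the matrix inverted here.\<close>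

definition schur_inv :: "nat \<Rightarrow> nat \<Rightarrow> real mat \<Rightarrow> real mat \<Rightarrow> real mat" where
  "schur_inv p q Y T =
    mat_inv (1\<^sub>m p + (Y * Y\<^sup>T + T * mat_inv (1\<^sub>m q + Y\<^sup>T * Y) * T\<^sup>T))"

text \<open>\<open>S = I + M M\<^sup>T\<close> for \<open>M = [Y, T Q, T Q Y\<^sup>T]\<close>, since \<open>Q = Q (Q + Y\<^sup>T Y Q)\<close>.\<close>

lemma schur_inv:
  fixes Y T :: "real mat"
  assumes Y: "Y \<in> carrier_mat p q" and T: "T \<in> carrier_mat p q"
  defines "S \<equiv> 1\<^sub>m p + (Y * Y\<^sup>T + T * mat_inv (1\<^sub>m q + Y\<^sup>T * Y) * T\<^sup>T)"
  shows "schur_inv p q Y T \<in> carrier_mat p p"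
    and "S * schur_inv p q Y T = 1\<^sub>m p"
    and "schur_inv p q Y T * S = 1\<^sub>m p"
proof -
  define Q where "Q = mat_inv (1\<^sub>m q + Y\<^sup>T * Y)"
  have YT: "Y\<^sup>T \<in> carrier_mat q p" using Y by simp
  note Q = gram_inv_carrier[OF YT, simplified, folded Q_def]
  note Q_eq = gram_inv_right[OF YT, simplified, folded Q_def]
  note Q_sym = gram_inv_sym[OF YT, simplified, folded Q_def]
  have d: "dim_row Y = p" "dim_col Y = q" "dim_row T = p" "dim_col T = q" "dim_row Q = q" "dim_col Q = q"
    using Y T Q by auto
  define M where "M = append_cols Y (append_cols (T * Q) (T * Q * Y\<^sup>T))"
  have TQT: "T * Q * T\<^sup>T = T * Q * (Q + Y\<^sup>T * Y * Q) * T\<^sup>T"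
    unfolding Q_eq using d by simp
  have "append_cols (T * Q) (T * Q * Y\<^sup>T) * (append_cols (T * Q) (T * Q * Y\<^sup>T))\<^sup>T = T * Q * T\<^sup>T"
    unfolding TQT using Y T Q
    by (subst append_cols_mult_transpose[of _ p q _ p _ p]) (auto simp: mat_ring_simps d Q_sym)
  then have "Y * Y\<^sup>T + T * Q * T\<^sup>T = M * M\<^sup>T"
    unfolding M_def using Y T Q by (subst append_cols_mult_transpose[of _ p q _ "q + p" _ p]) auto
  moreover have "M \<in> carrier_mat p (q + (q + p))" using d by (auto simp: M_def)
  ultimately have inv: "invertible_mat S"
    using invertible_one_plus_gram[of M p] by (simp add: S_def Q_def)
  have S: "S \<in> carrier_mat p p" using d by (auto simp: S_def)
  show "schur_inv p q Y T \<in> carrier_mat p p" "S * schur_inv p q Y T = 1\<^sub>m p"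
    "schur_inv p q Y T * S = 1\<^sub>m p"
    using mat_inv[OF S inv] unfolding schur_inv_def S_def by this+
qed

section \<open>Products with the inverse of the doubled block matrix\<close>

text \<open>Dividing only the row \<open>[U, F U]\<close> by the block matrix avoids writing down the full block inverse.\<close>

lemma doubled_row_mult_inv:
  fixes F U Y T :: "real mat"
  assumes F: "F \<in> carrier_mat n n" and U: "U \<in> carrier_mat n p"
    and Y: "Y \<in> carrier_mat p q" and T: "T \<in> carrier_mat p q"
  defines "P \<equiv> mat_inv (1\<^sub>m p + Y * Y\<^sup>T)"
    and "Y' \<equiv> four_block_mat (0\<^sub>m p q) Y Y T"
    and "Z \<equiv> (F * U - U * mat_inv (1\<^sub>m p + Y * Y\<^sup>T) * Y * T\<^sup>T) * schur_inv p q Y T"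
  shows "append_cols U (F * U) * mat_inv (1\<^sub>m (p + p) + Y' * Y'\<^sup>T)
    = append_cols (U * P - Z * T * Y\<^sup>T * P) Z"
proof -
  define Q where "Q = mat_inv (1\<^sub>m q + Y\<^sup>T * Y)"
  define W where "W = F * U - U * P * Y * T\<^sup>T"
  have YT: "Y\<^sup>T \<in> carrier_mat q p" using Y by simp
  note P = gram_inv_carrier[OF Y, folded P_def] and Q = gram_inv_carrier[OF YT, simplified, folded Q_def]
  note S = schur_inv[OF Y T, folded Q_def]
  note Z_eq = Z_def[folded P_def, folded W_def]
  have d: "dim_row Y = p" "dim_col Y = q" "dim_row T = p" "dim_col T = q" "dim_row Q = q" "dim_col Q = q"
    "dim_row P = p" "dim_col P = p" "dim_row U = n" "dim_col U = p" "dim_row F = n" "dim_col F = n"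
    "dim_row Z = n" "dim_col Z = p" "dim_row W = n" "dim_col W = p"
    "dim_row (schur_inv p q Y T) = p" "dim_col (schur_inv p q Y T) = p"
    using Y T P Q U F S by (auto simp: Z_eq W_def)
  have Y'_T: "Y'\<^sup>T = four_block_mat (0\<^sub>m q p) Y\<^sup>T Y\<^sup>T T\<^sup>T"
    unfolding Y'_def using Y T by (subst transpose_four_block_mat[of _ p q _ q _ p]) auto
  have "Y' * Y'\<^sup>T = four_block_mat (Y * Y\<^sup>T) (Y * T\<^sup>T) (T * Y\<^sup>T) (Y * Y\<^sup>T + T * T\<^sup>T)"
    unfolding Y'_T unfolding Y'_def using Y T
    by (subst mult_four_block_mat[of _ p q _ q _ p _ _ p _ p]) auto
  moreover have "four_block_mat (1\<^sub>m p) (0\<^sub>m p p) (0\<^sub>m p p) (1\<^sub>m p)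
        + four_block_mat (Y * Y\<^sup>T) (Y * T\<^sup>T) (T * Y\<^sup>T) (Y * Y\<^sup>T + T * T\<^sup>T)
      = four_block_mat (1\<^sub>m p + Y * Y\<^sup>T) (Y * T\<^sup>T) (T * Y\<^sup>T) (1\<^sub>m p + (Y * Y\<^sup>T + T * T\<^sup>T))"
    using Y T by (subst add_four_block_mat[of _ p p _ p _ p]) auto
  ultimately have E: "1\<^sub>m (p + p) + Y' * Y'\<^sup>T = four_block_mat (1\<^sub>m p + Y * Y\<^sup>T) (Y * T\<^sup>T)
      (T * Y\<^sup>T) (1\<^sub>m p + (Y * Y\<^sup>T + T * T\<^sup>T))"
    by simp
  have P1: "X * P + X * P * Y * Y\<^sup>T = X" if "dim_col X = p" for X
  proof -
    have "X * P + X * P * Y * Y\<^sup>T = X * (P + P * Y * Y\<^sup>T)" using that d by (simp add: mat_ring_simps)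
    then show ?thesis using that by (simp add: gram_inv_left[OF Y, folded P_def])
  qed
  have one: "U * P * (1\<^sub>m p + Y * Y\<^sup>T) = U" "Z * T * Y\<^sup>T * P * (1\<^sub>m p + Y * Y\<^sup>T) = Z * T * Y\<^sup>T"
    using P1[of U] P1[of "Z * T * Y\<^sup>T"] d by (auto simp: mat_ring_simps)
  \<comment> \<open>The candidate row is multiplied back: \<open>c1\<close> and \<open>c2\<close>
    are the two block columns of the product. Removing \<open>index_mult_mat(1)\<close> from the
    simplifier keeps products opaque, so the entrywise comparison involves only sums and
    differences.\<close>
  have c1: "(U * P - Z * T * Y\<^sup>T * P) * (1\<^sub>m p + Y * Y\<^sup>T) + Z * (T * Y\<^sup>T) = U"
    using d by (simp add: mat_minus_mult one) (auto intro!: eq_matI simp: mat_assoc simp del: index_mult_mat(1))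
  have ZS: "Z * (1\<^sub>m p + (Y * Y\<^sup>T + T * Q * T\<^sup>T)) = W"
    using S(3) d unfolding Z_eq by (simp add: mat_assoc)
  \<comment> \<open>This splits \<open>T T\<^sup>T\<close> into \<open>T Q T\<^sup>T\<close>, the
    part found in the Schur complement, and \<open>T Y\<^sup>T P Y T\<^sup>T\<close>, which cancels
    against the correction in the left block of the row.\<close>
  have "Q + Y\<^sup>T * (P * Y) = 1\<^sub>m q"
    using gram_inv_right[OF YT, simplified, folded Q_def] gram_inv_push[OF Y, folded P_def Q_def] d
    by (simp add: mat_assoc)
  then have "Z * (T * T\<^sup>T) = Z * T * (Q + Y\<^sup>T * (P * Y)) * T\<^sup>T" using d by (simp add: mat_assoc)
  then have ZTT: "Z * (T * T\<^sup>T) = Z * (T * (Q * T\<^sup>T)) + Z * (T * (Y\<^sup>T * (P * (Y * T\<^sup>T))))"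
    using d by (simp add: mat_ring_simps)
  have FU: "F * U = W + U * (P * (Y * T\<^sup>T))"
    unfolding W_def using d by (auto intro!: eq_matI simp: mat_assoc simp del: index_mult_mat(1))
  have c2: "(U * P - Z * T * Y\<^sup>T * P) * (Y * T\<^sup>T) + Z * (1\<^sub>m p + (Y * Y\<^sup>T + T * T\<^sup>T)) = F * U"
    unfolding FU ZS[symmetric] using d
    by (simp add: mat_ring_simps ZTT) (auto intro!: eq_matI simp del: index_mult_mat(1))
  have c: "1\<^sub>m (p + p) + Y' * Y'\<^sup>T \<in> carrier_mat (p + p) (p + p)" "Y' \<in> carrier_mat (p + p) (q + q)"
    using d by (auto simp: Y'_def)
  show ?thesis
  proof (rule mult_mat_inv_eqI[OF c(1) invertible_one_plus_gram[OF c(2)]])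
    show "append_cols (U * P - Z * T * Y\<^sup>T * P) Z \<in> carrier_mat n (p + p)" using d by auto
    show "append_cols (U * P - Z * T * Y\<^sup>T * P) Z * (1\<^sub>m (p + p) + Y' * Y'\<^sup>T) = append_cols U (F * U)"
      unfolding E
      by (subst append_cols_mult_four_block_mat[of _ n p _ p _ p _ p]) (use d c1 c2 in auto)
  qed
qed

text \<open>The right-hand side has the shape of an SDA update, the old Gram product plus a
  correction. The data \<open>F, U, Y, T\<close> serve \<open>G\<close>, and
  \<open>F\<^sup>T, V, Y\<^sup>T, T\<^sup>T\<close> serve \<open>H\<close>.\<close>

lemma doubled_gram:
  fixes F U Y T :: "real mat"
  assumes F: "F \<in> carrier_mat n n" and U: "U \<in> carrier_mat n p"
    and Y: "Y \<in> carrier_mat p q" and T: "T \<in> carrier_mat p q"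
  defines "P \<equiv> mat_inv (1\<^sub>m p + Y * Y\<^sup>T)"
    and "Y' \<equiv> four_block_mat (0\<^sub>m p q) Y Y T"
    and "W \<equiv> F * U - U * mat_inv (1\<^sub>m p + Y * Y\<^sup>T) * Y * T\<^sup>T"
  shows "append_cols U (F * U) * mat_inv (1\<^sub>m (p + p) + Y' * Y'\<^sup>T) * (append_cols U (F * U))\<^sup>T
    = U * P * U\<^sup>T + W * schur_inv p q Y T * W\<^sup>T"
proof -
  note P = gram_inv_carrier[OF Y, folded P_def] and P_sym = gram_inv_sym[OF Y, folded P_def]
  note S = schur_inv(1)[OF Y T]
  define Z where "Z = W * schur_inv p q Y T"
  have d: "dim_row Y = p" "dim_col Y = q" "dim_row T = p" "dim_col T = q"
    "dim_row P = p" "dim_col P = p" "dim_row U = n" "dim_col U = p" "dim_row F = n" "dim_col F = n"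
    "dim_row Z = n" "dim_col Z = p"
    using Y T P U F S by (auto simp: Z_def W_def)
  have "append_cols U (F * U) * mat_inv (1\<^sub>m (p + p) + Y' * Y'\<^sup>T) * (append_cols U (F * U))\<^sup>T
    = append_cols (U * P - Z * T * Y\<^sup>T * P) Z * (append_cols U (F * U))\<^sup>T"
    using doubled_row_mult_inv[OF F U Y T] by (simp add: P_def Y'_def Z_def W_def)
  also have "\<dots> = (U * P - Z * T * Y\<^sup>T * P) * U\<^sup>T + Z * (F * U)\<^sup>T"
    using d by (intro append_cols_mult_transpose[of _ n p _ p _ n]) auto
  \<comment> \<open>By symmetry of \<open>P\<close>, \<open>T Y\<^sup>T P U\<^sup>T\<close> is the
    transpose of \<open>U P Y T\<^sup>T\<close>, so the terms with \<open>Z\<close> combine to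
    \<open>Z W\<^sup>T\<close>.\<close>
  also have "\<dots> = U * P * U\<^sup>T + Z * W\<^sup>T"
    unfolding W_def P_def[symmetric] using d
    by (simp add: mat_ring_simps P_sym) (auto intro!: eq_matI simp del: index_mult_mat(1))
  finally show ?thesis by (simp add: Z_def)
qed

section \<open>One step of the doubling algorithm\<close>

text \<open>\<open>F\<close> stands for the current power of the initial matrix. Closed forms for
  \<open>J G\<close> and \<open>H J\<close> reduce the updates of \<open>G\<close> and
  \<open>H\<close> to \<open>doubled_gram\<close>; the update of \<open>A\<close> then follows from
  \<open>J = I - J G H\<close>.\<close>

lemma sda_step:
  fixes F U V Y A G H :: "real mat"
  assumes F: "F \<in> carrier_mat n n" and U: "U \<in> carrier_mat n p" and V: "V \<in> carrier_mat n q"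
    and Y: "Y \<in> carrier_mat p q"
  defines "P \<equiv> mat_inv (1\<^sub>m p + Y * Y\<^sup>T)" and "Q \<equiv> mat_inv (1\<^sub>m q + Y\<^sup>T * Y)"
    and "J \<equiv> mat_inv (1\<^sub>m n + G * H)"
    and "U' \<equiv> append_cols U (F * U)" and "V' \<equiv> append_cols V (F\<^sup>T * V)"
    and "Y' \<equiv> four_block_mat (0\<^sub>m p q) Y Y (U\<^sup>T * V)"
  assumes A_eq: "A = F - U * P * Y * V\<^sup>T" and G_eq: "G = U * P * U\<^sup>T" and H_eq: "H = V * Q * V\<^sup>T"
    and inv: "invertible_mat (1\<^sub>m n + G * H)"
  shows "A * J * A = F * F - U' * mat_inv (1\<^sub>m (p + p) + Y' * Y'\<^sup>T) * Y' * V'\<^sup>T"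
    and "G + A * J * G * A\<^sup>T = U' * mat_inv (1\<^sub>m (p + p) + Y' * Y'\<^sup>T) * U'\<^sup>T"
    and "H + A\<^sup>T * H * J * A = V' * mat_inv (1\<^sub>m (q + q) + Y'\<^sup>T * Y') * V'\<^sup>T"
proof -
  define T where "T = U\<^sup>T * V"
  \<comment> \<open>Here \<open>S\<close> and \<open>R\<close> are the inverses of the two Schur
    complements, not the complements themselves.\<close>
  define S where "S = schur_inv p q Y T"
  define R where "R = schur_inv q p Y\<^sup>T T\<^sup>T"
  define W where "W = F * U - U * P * Y * T\<^sup>T"
  define X where "X = F\<^sup>T * V - V * Q * Y\<^sup>T * T"
  have T: "T \<in> carrier_mat p q" using U V by (simp add: T_def)
  have YT: "Y\<^sup>T \<in> carrier_mat q p" and TT: "T\<^sup>T \<in> carrier_mat q p" and FT: "F\<^sup>T \<in> carrier_mat n n"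
    using Y T F by auto
  note P = gram_inv_carrier[OF Y, folded P_def] gram_inv_sym[OF Y, folded P_def]
  note Q = gram_inv_carrier[OF YT, simplified, folded Q_def] gram_inv_sym[OF YT, simplified, folded Q_def]
  note push = gram_inv_push[OF Y, folded P_def Q_def]
    gram_inv_push[OF YT, simplified, folded P_def Q_def]
  note S = schur_inv[OF Y T, folded S_def Q_def]
  note R = schur_inv[OF YT TT, simplified, folded R_def P_def]
  have GH: "1\<^sub>m n + G * H \<in> carrier_mat n n" using U V P Q by (auto simp: G_eq H_eq)
  note J = mat_inv[OF GH inv, folded J_def]
  have d: "dim_row Y = p" "dim_col Y = q" "dim_row T = p" "dim_col T = q" "dim_row Q = q" "dim_col Q = q"
    "dim_row P = p" "dim_col P = p" "dim_row U = n" "dim_col U = p" "dim_row V = n" "dim_col V = q"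
    "dim_row F = n" "dim_col F = n" "dim_row A = n" "dim_col A = n" "dim_row G = n" "dim_col G = n"
    "dim_row H = n" "dim_col H = n" "dim_row S = p" "dim_col S = p" "dim_row R = q" "dim_col R = q"
    "dim_row J = n" "dim_col J = n" "dim_row W = n" "dim_col W = p" "dim_row X = n" "dim_col X = q"
    using Y T P U V F S R J Q by (auto simp: A_eq G_eq H_eq W_def X_def)
  have TVU: "T\<^sup>T = V\<^sup>T * U" using d by (simp add: T_def mat_ring_simps)
  have AU: "A * U = W" unfolding A_eq W_def TVU using d by (simp add: mat_ring_simps)
  \<comment> \<open>Transposition leaves \<open>Y\<^sup>T P\<close>; pushing gives
    \<open>Q Y\<^sup>T\<close>, the form that occurs in \<open>X\<close>.\<close>
  have "A\<^sup>T = F\<^sup>T - V * Y\<^sup>T * P * U\<^sup>T" unfolding A_eq using d P by (simp add: mat_ring_simps)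
  also have "V * Y\<^sup>T * P * U\<^sup>T = V * (Q * Y\<^sup>T) * U\<^sup>T" unfolding push(2) using d by (simp add: mat_assoc)
  finally have AV: "A\<^sup>T * V = X" unfolding X_def T_def using d by (simp add: mat_ring_simps)
  have TQT: "T * Q * T\<^sup>T = T * Q * V\<^sup>T * U" "T\<^sup>T * P * T = T\<^sup>T * P * U\<^sup>T * V"
    using d by (simp_all add: TVU mat_assoc) (simp_all add: T_def mat_assoc d)
  \<comment> \<open>The factor on the right satisfies
    \<open>(I + G H) U = U (I + P T Q V\<^sup>T U)\<close>. Being \<open>P\<close> times the Schur
    complement, it gives \<open>(I + G H) U S U\<^sup>T = U P U\<^sup>T = G\<close>.\<close>
  have PS: "P * (1\<^sub>m p + (Y * Y\<^sup>T + T * Q * T\<^sup>T)) = 1\<^sub>m p + P * T * Q * V\<^sup>T * U"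
  proof -
    have "P * (1\<^sub>m p + (Y * Y\<^sup>T + T * Q * T\<^sup>T)) = (P + P * Y * Y\<^sup>T) + P * (T * Q * T\<^sup>T)"
      using d P by (simp add: mat_ring_simps) (auto intro!: eq_matI simp del: index_mult_mat(1))
    then show ?thesis
      unfolding gram_inv_left[OF Y, folded P_def] TQT using d by (simp add: mat_assoc)
  qed
  have "(1\<^sub>m n + G * H) * (U * S * U\<^sup>T) = U * ((1\<^sub>m p + P * T * Q * V\<^sup>T * U) * S) * U\<^sup>T"
    using d by (simp add: G_eq H_eq mat_ring_simps T_def)
  also have "\<dots> = U * (P * ((1\<^sub>m p + (Y * Y\<^sup>T + T * Q * T\<^sup>T)) * S)) * U\<^sup>T"
    unfolding PS[symmetric] using d by (simp add: mat_assoc)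
  also have "\<dots> = G" unfolding S(2) G_eq using P by simp
  finally have "J * ((1\<^sub>m n + G * H) * (U * S * U\<^sup>T)) = J * G" by simp
  moreover have "J * ((1\<^sub>m n + G * H) * (U * S * U\<^sup>T)) = J * (1\<^sub>m n + G * H) * (U * S * U\<^sup>T)"
    using d by (subst mat_assoc) auto
  ultimately have JG: "J * G = U * S * U\<^sup>T" using d by (simp add: J(3))
  \<comment> \<open>The mirror image multiplies by \<open>I + G H\<close> from the right, so it
    yields \<open>H J\<close> in the order needed for the update of \<open>H\<close>.\<close>
  have QR: "(1\<^sub>m q + (Y\<^sup>T * Y + T\<^sup>T * P * T)) * Q = 1\<^sub>m q + T\<^sup>T * P * U\<^sup>T * V * Q"
  proof -
    have "(1\<^sub>m q + (Y\<^sup>T * Y + T\<^sup>T * P * T)) * Q = (Q + Y\<^sup>T * Y * Q) + T\<^sup>T * P * T * Q"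
      using d Q by (simp add: mat_ring_simps) (auto intro!: eq_matI simp del: index_mult_mat(1))
    then show ?thesis
      unfolding gram_inv_right[OF YT, simplified, folded Q_def] TQT using d by (simp add: mat_assoc)
  qed
  have "(V * R * V\<^sup>T) * (1\<^sub>m n + G * H) = V * (R * (1\<^sub>m q + T\<^sup>T * P * U\<^sup>T * V * Q)) * V\<^sup>T"
    using d by (simp add: G_eq H_eq mat_ring_simps TVU)
  also have "\<dots> = V * (R * (1\<^sub>m q + (Y\<^sup>T * Y + T\<^sup>T * P * T)) * Q) * V\<^sup>T"
    unfolding QR[symmetric] using d by (simp add: mat_assoc)
  also have "\<dots> = H" unfolding R(3) H_eq using Q by simp
  finally have VRV: "V * R * V\<^sup>T * (1\<^sub>m n + G * H) = H" .
  have HJ: "H * J = V * R * V\<^sup>T"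
    unfolding J_def by (rule mult_mat_inv_eqI[OF GH inv _ VRV]) (use d in auto)

  have "A * J * G * A\<^sup>T = (A * U) * S * (A * U)\<^sup>T"
    using d by (simp add: mat_assoc[of _ J] JG) (simp add: mat_ring_simps d)
  then show "G + A * J * G * A\<^sup>T = U' * mat_inv (1\<^sub>m (p + p) + Y' * Y'\<^sup>T) * U'\<^sup>T"
    unfolding AU unfolding U'_def Y'_def T_def[symmetric] doubled_gram[OF F U Y T]
    by (simp add: G_eq P_def W_def S_def)
  \<comment> \<open>The transpose is the doubled matrix built from \<open>Y\<^sup>T\<close> and
    \<open>T\<^sup>T\<close>, so \<open>doubled_gram\<close> also covers \<open>H\<close>.\<close>
  have Y'_T: "Y'\<^sup>T = four_block_mat (0\<^sub>m q p) Y\<^sup>T Y\<^sup>T T\<^sup>T"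
    unfolding Y'_def T_def[symmetric] using Y T by (subst transpose_four_block_mat[of _ p q _ q _ p]) auto
  have "A\<^sup>T * H * J * A = (A\<^sup>T * V) * R * (A\<^sup>T * V)\<^sup>T"
    using d by (simp add: mat_assoc[of _ H] HJ) (simp add: mat_ring_simps d)
  then show "H + A\<^sup>T * H * J * A = V' * mat_inv (1\<^sub>m (q + q) + Y'\<^sup>T * Y') * V'\<^sup>T"
    unfolding AV using doubled_gram[OF FT V YT TT]
    by (simp add: V'_def Y'_T[symmetric] H_eq Q_def[symmetric] X_def R_def)

  define Z where "Z = W * S"
  have dZ: "dim_row Z = n" "dim_col Z = p" using d by (auto simp: Z_def)
  \<comment> \<open>Since \<open>J G\<close> is known, \<open>J = I - J G H\<close> reduces
    \<open>A J A\<close> to \<open>A A\<close> minus an explicit correction.\<close>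
  have "J + J * G * H = 1\<^sub>m n" using J(3) d by (simp add: mat_ring_simps)
  then have "J = 1\<^sub>m n - J * G * H"
    using d by (intro eq_matI) (auto simp del: index_mult_mat(1) simp flip: \<open>J + J * G * H = 1\<^sub>m n\<close>)
  then have "J = 1\<^sub>m n - U * S * T * Q * V\<^sup>T"
    unfolding JG H_eq T_def using d by (simp add: mat_assoc)
  moreover have AA: "A * A = A * F - A * U * P * Y * V\<^sup>T"
  proof -
    have "A * A = A * (F - U * P * Y * V\<^sup>T)" by (simp only: A_eq[symmetric])
    then show ?thesis using d by (simp add: mat_ring_simps)
  qed
  ultimately have "A * J * A = A * A - A * U * S * T * Q * V\<^sup>T * A"
    using d by (simp add: mat_ring_simps)
  also have "\<dots> = A * F - A * U * P * Y * V\<^sup>T - Z * T * Q * V\<^sup>T * A"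
    unfolding AA by (simp only: AU Z_def)
  also have "A * F = F * F - U * P * Y * V\<^sup>T * F" unfolding A_eq using d by (simp add: mat_ring_simps)
  also have "Z * T * Q * V\<^sup>T * A = Z * T * Q * V\<^sup>T * F - Z * (T * Q * T\<^sup>T) * P * Y * V\<^sup>T"
    unfolding A_eq TVU using d dZ by (simp add: mat_ring_simps)
  \<comment> \<open>Writing \<open>A U\<close> as \<open>Z\<close> times the Schur complement makes
    the \<open>T Q T\<^sup>T\<close> terms cancel; the rest collapses by
    \<open>P + Y Y\<^sup>T P = I\<close>.\<close>
  also have "A * U * P * Y * V\<^sup>T = Z * (1\<^sub>m p + (Y * Y\<^sup>T + T * Q * T\<^sup>T)) * P * Y * V\<^sup>T"
    unfolding AU Z_def using S(3) d by (simp add: mat_assoc[of _ S])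
  also have "\<dots> = Z * (P + Y * Y\<^sup>T * P) * Y * V\<^sup>T + Z * (T * Q * T\<^sup>T) * P * Y * V\<^sup>T"
    using d dZ by (simp add: mat_ring_simps) (auto intro!: eq_matI simp del: index_mult_mat(1))
  also have "Z * (P + Y * Y\<^sup>T * P) = Z"
    unfolding gram_inv_right[OF Y, folded P_def] using dZ by auto
  finally have AJA: "A * J * A = F * F - U * P * Y * V\<^sup>T * F - (Z * Y * V\<^sup>T + Z * T * Q * V\<^sup>T * F)"
    using d dZ by (auto intro!: eq_matI simp del: index_mult_mat(1))

  \<comment> \<open>The same splitting of the identity is used on the block side: one half of
    \<open>Z T V\<^sup>T F\<close> cancels the correction contributed by the left block, the other
    half occurs in \<open>AJA\<close>.\<close>
  have "Q + Y\<^sup>T * P * Y = 1\<^sub>m q"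
    using gram_inv_right[OF YT, simplified, folded Q_def] push(1) d by (simp add: mat_assoc)
  then have "Z * T * V\<^sup>T * F = Z * T * (Q + Y\<^sup>T * P * Y) * V\<^sup>T * F" using d dZ by (simp add: mat_assoc)
  also have "\<dots> = Z * T * Q * V\<^sup>T * F + Z * T * Y\<^sup>T * P * Y * V\<^sup>T * F" using d dZ by (simp add: mat_ring_simps)
  finally have ZT: "Z * T * V\<^sup>T * F = \<dots>" .
  have ZY: "0\<^sub>m n q + Z * Y = Z * Y"
    using d dZ by (intro left_add_zero_mat carrier_matI) auto
  have "U' * mat_inv (1\<^sub>m (p + p) + Y' * Y'\<^sup>T) * Y' = append_cols (U * P - Z * T * Y\<^sup>T * P) Z * Y'"
    using doubled_row_mult_inv[OF F U Y T]
    by (simp add: U'_def Y'_def T_def[symmetric] Z_def W_def S_def P_def)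
  also have "\<dots> = append_cols (Z * Y) ((U * P - Z * T * Y\<^sup>T * P) * Y + Z * T)"
    unfolding Y'_def T_def[symmetric] using d dZ
    by (subst append_cols_mult_four_block_mat[of _ n p _ p _ q _ q]) (use ZY in auto)
  finally have "U' * mat_inv (1\<^sub>m (p + p) + Y' * Y'\<^sup>T) * Y' * V'\<^sup>T =
      Z * Y * V\<^sup>T + ((U * P - Z * T * Y\<^sup>T * P) * Y + Z * T) * (F\<^sup>T * V)\<^sup>T"
    unfolding V'_def
    by (simp only:) (rule append_cols_mult_transpose[of _ n q _ q _ n], use d dZ in auto)
  also have "\<dots> = Z * Y * V\<^sup>T + (U * P * Y * V\<^sup>T * F - Z * T * Y\<^sup>T * P * Y * V\<^sup>T * F + Z * T * V\<^sup>T * F)"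
    using d dZ by (simp add: mat_ring_simps)
  also have "\<dots> = U * P * Y * V\<^sup>T * F + (Z * Y * V\<^sup>T + Z * T * Q * V\<^sup>T * F)"
    unfolding ZT using d dZ by (auto intro!: eq_matI simp del: index_mult_mat(1))
  finally show "A * J * A = F * F - U' * mat_inv (1\<^sub>m (p + p) + Y' * Y'\<^sup>T) * Y' * V'\<^sup>T"
    unfolding AJA using d dZ by (auto intro!: eq_matI simp del: index_mult_mat(1))
qed

section \<open>Krylov block rows and matrix powers\<close>

lemma krylov_shift:
  fixes A :: "'a :: semiring_1 mat"
  assumes A: "A \<in> carrier_mat n n" and W: "\<And>j. W j \<in> carrier_mat n p"
    and rec: "\<And>j. W (Suc j) = A * W j"
  shows "W (j + N) = A ^\<^sub>m N * W j"
proof (induction N arbitrary: j)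
  case 0
  show ?case using A W[of j] by simp
next
  case (Suc N)
  have "W (j + Suc N) = A ^\<^sub>m N * (A * W j)" using Suc[of "Suc j"] rec[of j] by simp
  also have "\<dots> = A ^\<^sub>m Suc N * W j"
    using A W[of j] by (simp add: assoc_mult_mat[of _ n n _ n _ p])
  finally show ?case .
qed

lemma pow_mat_add:
  fixes A :: "'a :: semiring_1 mat"
  assumes "A \<in> carrier_mat n n"
  shows "A ^\<^sub>m (i + j) = A ^\<^sub>m i * A ^\<^sub>m j"
  using assms by (induction j) (auto simp: assoc_mult_mat[of _ n n _ n _ n])

lemma transpose_pow_mat:
  fixes A :: "'a :: comm_semiring_1 mat"
  assumes A: "A \<in> carrier_mat n n"
  shows "(A ^\<^sub>m N)\<^sup>T = A\<^sup>T ^\<^sub>m N"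
proof (induction N)
  case 0
  show ?case using A by simp
next
  case (Suc N)
  \<comment> \<open>A successor power unfolds with its new factor on the right. Moving that factor
    to the left lets the transposed product end in \<open>A\<^sup>T\<close>.\<close>
  have "(A ^\<^sub>m Suc N)\<^sup>T = (A * A ^\<^sub>m N)\<^sup>T"
    using pow_mat_add[OF A, of 1 N] A by simp
  also have "\<dots> = A\<^sup>T ^\<^sub>m Suc N" using A by (simp add: mat_transpose_mult Suc)
  finally show ?case .
qed

text \<open>The second \<open>N\<close> blocks are the first \<open>N\<close> multiplied by the
  \<open>N\<close>-th power of \<open>A\<close>. For \<open>N = 2 ^ k\<close> this gives the block
  row \<open>[U, F U]\<close> of the SDA step.\<close>

lemma krylov_block_row:
  fixes A :: "'a :: semiring_1 mat"
  assumes A: "A \<in> carrier_mat n n" and W: "\<And>j. W j \<in> carrier_mat n p"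
    and rec: "\<And>j. W (Suc j) = A * W j"
  shows "block_row n (map W [0..<N]) \<in> carrier_mat n (N * p)"
    and "block_row n (map W [0..<N + N])
      = append_cols (block_row n (map W [0..<N])) (A ^\<^sub>m N * block_row n (map W [0..<N]))"
proof -
  have dim: "dim_row (W j) = n" "dim_col (W j) = p" for j using W[of j] by auto
  show "block_row n (map W [0..<N]) \<in> carrier_mat n (N * p)"
    by (intro carrier_matI) (simp_all add: dim_col_block_row comp_def dim sum_list_triv)
  have "map W [0..<N + N] = map W [0..<N] @ map (\<lambda>j. W (j + N)) [0..<N]"
    by (auto intro!: nth_equalityI simp: nth_append)
  also have "map (\<lambda>j. W (j + N)) [0..<N] = map ((*) (A ^\<^sub>m N)) (map W [0..<N])"
    using krylov_shift[where W = W, OF A W rec] by simp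
  finally show "block_row n (map W [0..<N + N])
      = append_cols (block_row n (map W [0..<N])) (A ^\<^sub>m N * block_row n (map W [0..<N]))"
    using A dim by (simp add: block_row_append mult_block_row del: map_map)
qed

theorem theorem3p1:
  fixes n m l :: nat
    and A B C :: "real mat"
    and Ak Gk Hk U V Uhat Vhat T Y :: "nat \<Rightarrow> real mat"
  assumes pos: "0 < n" "0 < m" "0 < l"
    and le: "m \<le> n" "l \<le> n"
    and A: "A \<in> carrier_mat n n"
    and B: "B \<in> carrier_mat n m"
    and C: "C \<in> carrier_mat l n"
    and rank_B: "vec_space.rank n B = m"
    and rank_C: "vec_space.rank n (C\<^sup>T) = l"
    and SDA_0: "Ak 0 = A" "Gk 0 = B * B\<^sup>T" "Hk 0 = C\<^sup>T * C"
    and A_Suc: "\<And>k. Ak (Suc k) = Ak k * mat_inv (1\<^sub>m n + Gk k * Hk k) * Ak k"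
    and G_Suc: "\<And>k. Gk (Suc k) =
      Gk k + Ak k * mat_inv (1\<^sub>m n + Gk k * Hk k) * Gk k * (Ak k)\<^sup>T"
    and H_Suc: "\<And>k. Hk (Suc k) =
      Hk k + (Ak k)\<^sup>T * Hk k * mat_inv (1\<^sub>m n + Gk k * Hk k) * Ak k"
    and nonsingular: "\<And>k. invertible_mat (1\<^sub>m n + Gk k * Hk k)"
    and U_0: "U 0 = B"
    and V_0: "V 0 = C\<^sup>T"
    and U_rec: "\<And>j. j \<ge> 1 \<Longrightarrow> U j = Ak 0 * U (j - 1)"
    and V_rec: "\<And>j. j \<ge> 1 \<Longrightarrow> V j = (Ak 0)\<^sup>T * V (j - 1)"
    and Uhat: "\<And>k. k \<ge> 1 \<Longrightarrow> Uhat k = block_row n (map U [0..<2 ^ k])"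
    and Vhat: "\<And>k. k \<ge> 1 \<Longrightarrow> Vhat k = block_row n (map V [0..<2 ^ k])"
    and T: "\<And>k. k \<ge> 1 \<Longrightarrow> T k = (Uhat k)\<^sup>T * Vhat k"
    and Y_1: "Y 1 = four_block_mat (0\<^sub>m m l) (0\<^sub>m m l) (0\<^sub>m m l) (B\<^sup>T * C\<^sup>T)"
    and Y_rec: "\<And>k. k \<ge> 2 \<Longrightarrow> Y k =
      four_block_mat (0\<^sub>m (2 ^ (k - 1) * m) (2 ^ (k - 1) * l)) (Y (k - 1)) (Y (k - 1)) (T (k - 1))"
  shows "\<forall>k\<ge>2.
      Ak k = Ak 0 ^\<^sub>m (2 ^ k)
        - Uhat k * mat_inv (1\<^sub>m (2 ^ k * m) + Y k * (Y k)\<^sup>T) * Y k * (Vhat k)\<^sup>T \<and>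
      Gk k = Uhat k * mat_inv (1\<^sub>m (2 ^ k * m) + Y k * (Y k)\<^sup>T) * (Uhat k)\<^sup>T \<and>
      Hk k = Vhat k * mat_inv (1\<^sub>m (2 ^ k * l) + (Y k)\<^sup>T * Y k) * (Vhat k)\<^sup>T"
proof -

  \<comment> \<open>Induction on the number of doubling steps\<close>
  define u where "u k = block_row n (map U [0..<2 ^ k])" for k :: nat
  define v where "v k = block_row n (map V [0..<2 ^ k])" for k :: nat
  \<comment> \<open>Index 0 is added as the start of the induction. With a zero matrix there, the
    given \<open>Y 1\<close> becomes an instance of the doubling recursion, because
    \<open>(u 0)\<^sup>T * v 0 = B\<^sup>T * C\<^sup>T\<close>.\<close>
  define y where "y k = (if k = 0 then 0\<^sub>m m l else Y k)" for k :: nat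
  have AT: "A\<^sup>T \<in> carrier_mat n n" using A by simp
  have U_Suc: "U (Suc j) = A * U j" and V_Suc: "V (Suc j) = A\<^sup>T * V j" for j
    using U_rec[of "Suc j"] V_rec[of "Suc j"] SDA_0 by auto
  have U: "U j \<in> carrier_mat n m" for j by (induction j) (use A B U_0 U_Suc in auto)
  have V: "V j \<in> carrier_mat n l" for j by (induction j) (use A C V_0 V_Suc in auto)
  have u: "u k \<in> carrier_mat n (2 ^ k * m)"
    and u_Suc: "u (Suc k) = append_cols (u k) (A ^\<^sub>m 2 ^ k * u k)" for k
    using krylov_block_row[where W = U and N = "2 ^ k", OF A U U_Suc] by (auto simp: u_def mult_2)
  have v: "v k \<in> carrier_mat n (2 ^ k * l)"
    and v_Suc: "v (Suc k) = append_cols (v k) ((A ^\<^sub>m 2 ^ k)\<^sup>T * v k)" for k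
    using krylov_block_row[where W = V and N = "2 ^ k", OF AT V V_Suc]
    by (auto simp: v_def mult_2 transpose_pow_mat[OF A])
  have uv_0: "u 0 = B" "v 0 = C\<^sup>T" "y 0 = 0\<^sub>m m l"
    using block_row_singleton[OF U[of 0]] block_row_singleton[OF V[of 0]]
    by (simp_all add: u_def v_def y_def U_0 V_0)
  have y_Suc: "y (Suc k)
      = four_block_mat (0\<^sub>m (2 ^ k * m) (2 ^ k * l)) (y k) (y k) ((u k)\<^sup>T * v k)" for k
  proof (cases k)
    case 0
    then show ?thesis using Y_1 uv_0 by (simp add: y_def)
  next
    case (Suc j)
    then show ?thesis using Y_rec[of "Suc k"] T[of k] Uhat[of k] Vhat[of k]
      by (simp add: y_def u_def v_def)
  qed
  have y: "y k \<in> carrier_mat (2 ^ k * m) (2 ^ k * l)" for k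
  proof (induction k)
    case 0
    show ?case by (simp add: uv_0)
  next
    case (Suc k)
    have "y (Suc k) \<in> carrier_mat (2 ^ k * m + 2 ^ k * m) (2 ^ k * l + 2 ^ k * l)"
      unfolding y_Suc using u[of k] v[of k] by (intro four_block_carrier_mat) auto
    then show ?case by (simp add: mult_2 add_mult_distrib)
  qed
  have rep: "Ak k = A ^\<^sub>m 2 ^ k - u k * mat_inv (1\<^sub>m (2 ^ k * m) + y k * (y k)\<^sup>T) * y k * (v k)\<^sup>T \<and>
      Gk k = u k * mat_inv (1\<^sub>m (2 ^ k * m) + y k * (y k)\<^sup>T) * (u k)\<^sup>T \<and>
      Hk k = v k * mat_inv (1\<^sub>m (2 ^ k * l) + (y k)\<^sup>T * y k) * (v k)\<^sup>T" for k
  proof (induction k)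
    case 0
    \<comment> \<open>For \<open>Y = 0\<close> both inverses are identities, so the representation
      reads \<open>A - 0\<close>, \<open>B B\<^sup>T\<close> and \<open>C\<^sup>T C\<close>.\<close>
    have "mat_inv (1\<^sub>m p + 0\<^sub>m p q * (0\<^sub>m p q)\<^sup>T) = (1\<^sub>m p :: real mat)" for p q
      using gram_inv_left[of "0\<^sub>m p q" p q] gram_inv_carrier[of "0\<^sub>m p q" p q] by simp
    from this[of m l] this[of l m]
    have "mat_inv (1\<^sub>m m) = (1\<^sub>m m :: real mat)" "mat_inv (1\<^sub>m l) = (1\<^sub>m l :: real mat)"
      by simp_all
    moreover have "A - 0\<^sub>m n n = A" using A by (intro eq_matI) auto
    ultimately show ?case
      using A B C by (simp add: uv_0 SDA_0)
  next
    case (Suc k)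
    have F: "A ^\<^sub>m 2 ^ k \<in> carrier_mat n n" using A by simp
    from Suc have eqs:
      "Ak k = A ^\<^sub>m 2 ^ k - u k * mat_inv (1\<^sub>m (2 ^ k * m) + y k * (y k)\<^sup>T) * y k * (v k)\<^sup>T"
      "Gk k = u k * mat_inv (1\<^sub>m (2 ^ k * m) + y k * (y k)\<^sup>T) * (u k)\<^sup>T"
      "Hk k = v k * mat_inv (1\<^sub>m (2 ^ k * l) + (y k)\<^sup>T * y k) * (v k)\<^sup>T"
      by blast+
    have "A ^\<^sub>m 2 ^ Suc k = A ^\<^sub>m 2 ^ k * A ^\<^sub>m 2 ^ k"
      using pow_mat_add[OF A] by (simp add: mult_2)
    moreover have "2 ^ Suc k * m = 2 ^ k * m + 2 ^ k * m" "2 ^ Suc k * l = 2 ^ k * l + 2 ^ k * l"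
      by auto
    ultimately show ?case
      using sda_step[OF F u v y eqs nonsingular[of k]]
      by (simp only: A_Suc G_Suc H_Suc u_Suc v_Suc y_Suc)
  qed
  show ?thesis
  proof (intro allI impI)
    fix k :: nat
    assume "2 \<le> k"
    then have "Uhat k = u k" "Vhat k = v k" "Y k = y k"
      using Uhat[of k] Vhat[of k] by (auto simp: u_def v_def y_def)
    then show "Ak k = Ak 0 ^\<^sub>m (2 ^ k)
        - Uhat k * mat_inv (1\<^sub>m (2 ^ k * m) + Y k * (Y k)\<^sup>T) * Y k * (Vhat k)\<^sup>T \<and>
      Gk k = Uhat k * mat_inv (1\<^sub>m (2 ^ k * m) + Y k * (Y k)\<^sup>T) * (Uhat k)\<^sup>T \<and>
      Hk k = Vhat k * mat_inv (1\<^sub>m (2 ^ k * l) + (Y k)\<^sup>T * Y k) * (Vhat k)\<^sup>T"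
      using rep[of k] SDA_0(1) by argo
  qed
qed

end
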